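(* Let $R$ be an associative ring with unity $1$, and let $p, q \in R$ be idempotents (i.e. $p^2=p$ and $q^2=q$). Then the following statements are equivalent: (1) $p-q\in R^D$; (2) $1-pq\in R^D$; (3) $p+q-pq\in R^D$.
   Context: An element $a\in R$ is Drazin invertible if there exists $b\in R$ such that $ab=ba$, $bab=b$, and $a^k=a^{k+1}b$ for some positive integer $k$; such $b$ is unique if it exists and is denoted $a^D$. $R^D$ denotes the set of all Drazin invertible elements of $R$. The ring $R$ is not assumed commutative. *)

theory Defs
  imports Main
begin

definition is_drazin_inverse :: "'a::monoid_mult \<Rightarrow> 'a \<Rightarrow> bool" where
  "is_drazin_inverse a b \<longleftrightarrow>
     a * b = b * a \<and> b * a * b = b \<and> (\<exists>k::nat. k > 0 \<and> a ^ k = a ^ (k + 1) * b)"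

(* The set written R^D for a ring R; here R is the type 'a. A ring with unity is a type of sort
   {ring, monoid_mult}, which unlike ring_1 does not impose 0 \<noteq> 1 and so includes the zero
   ring. *)
definition drazin_invertibles :: "'a::monoid_mult set" where
  "drazin_invertibles = {a. \<exists>b. is_drazin_inverse a b}"

end

theory Submission
  imports Defs
begin

text \<open>
  Write \<open>p' = 1 - p\<close>, \<open>q' = 1 - q\<close>. The square \<open>c = (p - q)\<^sup>2\<close> commutes with \<open>p\<close>, with
  \<open>p c = p - p q p\<close> and \<open>p' c = p' q p'\<close>; hence \<open>p - q\<close> is Drazin invertible iff both corners are.
  By the Jacobson-type exchange of \<open>1 - x y\<close> and \<open>1 - y x\<close>, the first corner is Drazin invertible
  iff \<open>1 - p q\<close> is, and, applied to \<open>p'\<close> and \<open>q'\<close>, the second one iff \<open>1 - p' q' = p + q - p q\<close> is.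
  Finally \<open>1 - p q\<close> and \<open>1 - q p\<close> are exchanged once more, and by Cline's formula
  \<open>q - q p q = q p' q\<close> is Drazin invertible iff \<open>p' q p'\<close> is, so each corner controls the other.
\<close>

section \<open>Absorption of powers and basic facts on Drazin inverses\<close>

lemma pow_absorb_iterate:
  fixes a c :: "'a::monoid_mult"
  assumes "a ^ k = a ^ (k + 1) * c"
  shows "a ^ (k + j) * c ^ j = a ^ k"
proof (induction j)
  case (Suc j)
  have "a ^ (k + Suc j) = a ^ j * a ^ (k + 1)"
    by (simp only: power_add[symmetric]) (simp add: add.commute)
  then have "a ^ (k + Suc j) * c ^ Suc j = a ^ j * (a ^ (k + 1) * c) * c ^ j"
    by (simp only: power_Suc mult.assoc)
  also have "\<dots> = a ^ (k + j) * c ^ j"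
    by (simp only: assms[symmetric]) (simp add: add.commute flip: power_add)
  finally show ?case using Suc by simp
qed simp

lemma pow_absorb_mono:
  fixes a c :: "'a::monoid_mult"
  assumes "a ^ k = a ^ (k + 1) * c" and "k \<le> n"
  shows "a ^ n = a ^ (n + 1) * c"
proof -
  have "a ^ n = a ^ (n - k) * a ^ k"
    using assms(2) by (simp flip: power_add)
  also have "\<dots> = a ^ (n - k) * a ^ (k + 1) * c"
    by (subst assms(1)) (simp add: mult.assoc)
  also have "\<dots> = a ^ (n + 1) * c"
    using assms(2) by (simp only: power_add[symmetric]) simp
  finally show ?thesis .
qed

text \<open>The Drazin inverse is \<open>a\<^sup>k c\<^sup>k\<^sup>+\<^sup>1\<close>, after replacing \<open>k\<close> by \<open>k + 1\<close> to make it positive.\<close>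

lemma drazin_invertiblesI:
  fixes a c :: "'a::monoid_mult"
  assumes comm: "a * c = c * a" and ak: "a ^ k = a ^ (k + 1) * c"
  shows "a \<in> drazin_invertibles"
proof -
  define n where "n = Suc k"
  have an: "a ^ n = a ^ (n + 1) * c"
    using pow_absorb_mono[OF ak, of n] by (simp add: n_def)
  define d where "d = a ^ n * c ^ Suc n"
  have ca: "c ^ i * a = a * c ^ i" for i
    using power_commuting_commutes[of c a i] comm by simp
  have caj: "c ^ i * a ^ j = a ^ j * c ^ i" for i j
    using power_commuting_commutes[of a "c ^ i" j] ca by simp
  have ad: "a * d = d * a"
    unfolding d_def
    by (simp only: mult.assoc ca) (simp only: mult.assoc[symmetric] power_commutes)
  have ad_pow: "a ^ (n + 1) * d = a ^ n"
  proof -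
    have "a ^ (n + 1) * d = a ^ (n + Suc n) * c ^ Suc n"
      unfolding d_def by (simp only: mult.assoc[symmetric] power_add[symmetric]) (simp add: add.commute)
    then show ?thesis
      by (simp only: pow_absorb_iterate[OF an])
  qed
  \<comment> \<open>After moving \<open>a\<close> to the front, one factor \<open>d\<close> is
    written out; \<open>ad_pow\<close> then collapses the right side to \<open>d\<close>
    again.\<close>
  have "d * a * d = a ^ (n + 1) * d * c ^ Suc n"
  proof -
    have "c ^ Suc n * d = d * c ^ Suc n"
      unfolding d_def by (metis caj mult.assoc)
    then have "a ^ (n + 1) * d * c ^ Suc n = a * a ^ n * c ^ Suc n * d"
      by (simp add: mult.assoc)
    also have "\<dots> = a * d * d"
      by (simp add: d_def mult.assoc)
    finally show ?thesis using ad by simp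
  qed
  then have dad: "d * a * d = d"
    unfolding ad_pow by (simp add: d_def)
  have "is_drazin_inverse a d"
    unfolding is_drazin_inverse_def using ad dad ad_pow by (metis n_def zero_less_Suc)
  then show ?thesis
    by (auto simp: drazin_invertibles_def)
qed

lemma drazin_invertiblesE:
  fixes a :: "'a::monoid_mult"
  assumes "a \<in> drazin_invertibles"
  obtains c k where "a * c = c * a" "c * a * c = c" "k > 0" "a ^ k = a ^ (k + 1) * c"
  using assms unfolding drazin_invertibles_def is_drazin_inverse_def by blast

text \<open>The relations give \<open>c = c ^ Suc k * a ^ k = a ^ k * c ^ Suc k\<close>, so
  \<open>d\<close> can be moved past the power of \<open>a\<close>. This turns both
  \<open>c * d\<close> and \<open>d * c\<close> into \<open>c * a * d * c\<close>.\<close>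

lemma drazin_inverse_double_commute:
  fixes a c d :: "'a::monoid_mult"
  assumes comm: "a * c = c * a" and cac: "c * a * c = c" and ak: "a ^ k = a ^ (k + 1) * c"
    and ad: "a * d = d * a"
  shows "c * d = d * c"
proof -
  have akd: "a ^ k * d = d * a ^ k"
    using power_commuting_commutes[OF ad] .
  have ck: "c = c ^ Suc n * a ^ n" for n
  proof (induction n)
    case (Suc n)
    have "c ^ Suc (Suc n) * a ^ Suc n = c * (c ^ Suc n * a ^ n) * a"
      by (simp add: mult.assoc power_commutes)
    also have "\<dots> = c" using Suc comm cac by (simp add: mult.assoc)
    finally show ?case by simp
  qed simp
  have kc: "c = a ^ k * c ^ Suc k"
    using ck[of k] power_commuting_commutes[of a "c ^ Suc k" k]
      power_commuting_commutes[of c a "Suc k"] comm by simp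
  have aac: "a ^ k * (a * c) = a ^ k"
    using ak[symmetric] by (simp only: power_add power_one_right mult.assoc)
  have ak': "a ^ k = c * a ^ (k + 1)"
    using ak power_commuting_commutes[OF comm, of "k + 1"] by simp
  \<comment> \<open>With \<open>a ^ k\<close> on the far right, \<open>aac\<close> allows the factor
    \<open>a * c\<close> to be appended; the computation of \<open>d * c\<close> is the mirror
    image.\<close>
  have "c * d = c ^ Suc k * (d * a ^ k)"
    using ck[of k] akd by (metis mult.assoc)
  also have "\<dots> = c ^ Suc k * (d * a ^ k) * (a * c)"
    by (simp only: mult.assoc aac)
  also have "\<dots> = c * d * (a * c)"
    using ck[of k] akd by (metis mult.assoc)
  finally have 1: "c * d = c * d * (a * c)" .
  have "d * c = (a ^ k * d) * c ^ Suc k"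
    using kc akd by (metis mult.assoc)
  also have "\<dots> = (c * a) * (a ^ k * d) * c ^ Suc k"
    using ak' by (metis add.commute mult.assoc plus_1_eq_Suc power_Suc)
  also have "\<dots> = (c * a) * (d * c)"
    using kc akd by (metis mult.assoc)
  finally have "d * c = c * a * (d * c)" .
  with 1 show ?thesis using ad by (metis mult.assoc)
qed

section \<open>Exchanging the two factors of a product\<close>

lemma power_mult_swap:
  fixes x y :: "'a::monoid_mult"
  shows "(y * x) ^ n * y = y * (x * y) ^ n"
  by (induction n) (simp_all add: mult.assoc)

text \<open>Cline's formula: the inverse for \<open>y * x\<close> is \<open>y * (c * c) * x\<close>,
  where \<open>c\<close> is the one for \<open>x * y\<close>.\<close>

lemma cline_drazin:
  fixes x y :: "'a::monoid_mult"
  assumes "x * y \<in> drazin_invertibles"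
  shows "y * x \<in> drazin_invertibles"
proof -
  obtain c k where comm: "x * y * c = c * (x * y)" and cac: "c * (x * y) * c = c"
    and ck: "(x * y) ^ k = (x * y) ^ (k + 1) * c"
    using assms by (elim drazin_invertiblesE)
  have 1: "x * y * (c * c) = c"
    using comm cac by (metis mult.assoc)
  have 2: "c * c * (x * y) = c"
    using comm cac by (metis mult.assoc)
  show ?thesis
  \<comment> \<open>The index grows by one because \<open>y * (x * y) ^ k * x\<close> is
    \<open>(y * x) ^ (k + 1)\<close>.\<close>
  proof (rule drazin_invertiblesI[where c = "y * (c * c) * x" and k = "k + 1"])
    have "y * x * (y * (c * c) * x) = y * (x * y * (c * c)) * x"
      by (simp only: mult.assoc)
    also have "\<dots> = y * (c * c * (x * y)) * x"
      by (simp only: 1 2)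
    finally show "y * x * (y * (c * c) * x) = y * (c * c) * x * (y * x)"
      by (simp only: mult.assoc)
    have "(y * x) ^ (k + 1 + 1) * (y * (c * c) * x) = (y * x) ^ (k + 1 + 1) * y * (c * c) * x"
      by (simp add: mult.assoc)
    also have "\<dots> = y * ((x * y) ^ (k + 1 + 1) * (c * c)) * x"
      by (simp only: power_mult_swap mult.assoc)
    also have "(x * y) ^ (k + 1 + 1) * (c * c) = (x * y) ^ (k + 1) * (x * y * (c * c))"
      by (simp only: power_add power_one_right mult.assoc)
    also have "\<dots> = (x * y) ^ (k + 1) * c"
      by (simp only: 1)
    also have "\<dots> = (x * y) ^ k" using ck by simp
    also have "y * (x * y) ^ k * x = (y * x) ^ (k + 1)"
      unfolding power_mult_swap[symmetric] by (simp only: power_add power_one_right mult.assoc)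
    finally show "(y * x) ^ (k + 1) = (y * x) ^ (k + 1 + 1) * (y * (c * c) * x)" ..
  qed
qed

text \<open>The witness \<open>1 + y * c * x\<close> imitates the classical inverse of
  \<open>1 - y * x\<close>. Its product with \<open>b\<close> misses \<open>1\<close> by
  \<open>y * t * x\<close>, and this error is killed by \<open>b ^ k\<close>, since
  \<open>b ^ k * y = y * a ^ k\<close> and \<open>a ^ k * t = 0\<close>.\<close>

lemma jacobson_drazin:
  fixes x y :: "'a::{ring, monoid_mult}"
  assumes "1 - x * y \<in> drazin_invertibles"
  shows "1 - y * x \<in> drazin_invertibles"
proof -
  define a where "a = 1 - x * y"
  define b where "b = 1 - y * x"
  obtain c k where comm: "a * c = c * a" and ck: "a ^ k = a ^ (k + 1) * c"
    using assms by (auto simp: a_def elim: drazin_invertiblesE)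
  define t where "t = 1 - a * c"
  have by': "b * y = y * a" and xb: "x * b = a * x"
    by (simp_all add: a_def b_def algebra_simps)
  have bky: "b ^ n * y = y * a ^ n" for n
  proof (induction n)
    case (Suc n)
    have "b ^ Suc n * y = b * (b ^ n * y)" by (simp add: mult.assoc)
    also have "\<dots> = y * a ^ Suc n" using Suc by' by (simp flip: mult.assoc)
    finally show ?case .
  qed simp
  have akt: "a ^ k * t = 0"
    using ck by (simp add: t_def right_diff_distrib power_commutes flip: mult.assoc)
  have bc: "b * (1 + y * c * x) = 1 - y * t * x"
  proof -
    have "b * (1 + y * c * x) = b + (b * y) * c * x"
      by (simp add: distrib_left mult.assoc)
    then show ?thesis
      unfolding by' by (simp add: b_def t_def algebra_simps)
  qed
  have cb: "(1 + y * c * x) * b = 1 - y * t * x"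
  proof -
    have "(1 + y * c * x) * b = b + y * c * (x * b)"
      by (simp add: distrib_right mult.assoc)
    also have "\<dots> = b + y * (c * a) * x"
      unfolding xb by (simp add: mult.assoc)
    also have "\<dots> = 1 - y * t * x"
      unfolding comm[symmetric] by (simp add: b_def t_def algebra_simps)
    finally show ?thesis .
  qed
  have "b ^ (k + 1) * (1 + y * c * x) = b ^ k * (1 - y * t * x)"
    unfolding bc[symmetric] by (simp only: Suc_eq_plus1[symmetric] power_Suc2 mult.assoc)
  also have "\<dots> = b ^ k - (b ^ k * y) * t * x"
    by (simp add: right_diff_distrib mult.assoc)
  also have "(b ^ k * y) * t * x = y * (a ^ k * t) * x"
    by (simp add: bky mult.assoc)
  finally have "b ^ k = b ^ (k + 1) * (1 + y * c * x)"
    by (simp add: akt)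
  with bc cb have "b \<in> drazin_invertibles"
    by (intro drazin_invertiblesI) auto
  then show ?thesis by (simp add: b_def)
qed

section \<open>Squares and splitting along a commuting idempotent\<close>

lemma square_drazin_iff:
  fixes a :: "'a::monoid_mult"
  shows "a * a \<in> drazin_invertibles \<longleftrightarrow> a \<in> drazin_invertibles"
proof
  assume "a * a \<in> drazin_invertibles"
  then obtain c k where comm: "a * a * c = c * (a * a)" and cac: "c * (a * a) * c = c"
    and ck: "(a * a) ^ k = (a * a) ^ (k + 1) * c"
    by (elim drazin_invertiblesE)
  \<comment> \<open>Double commutation applies because \<open>a\<close> commutes with its own
    square; hence \<open>a * c\<close> can serve as witness for \<open>a\<close>.\<close>
  have ca: "c * a = a * c"
    by (rule drazin_inverse_double_commute[OF comm cac ck]) (simp add: mult.assoc)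
  have pow: "(a * a) ^ n = a ^ (2 * n)" for n
    by (simp add: power_mult power2_eq_square)
  have "a ^ (2 * k) = a ^ (2 * k + 1) * (a * c)"
    using ck unfolding pow by (simp add: mult.assoc power_commutes)
      (metis mult.assoc power_commutes)
  then show "a \<in> drazin_invertibles"
    by (rule drazin_invertiblesI[rotated]) (simp add: ca mult.assoc)
next
  assume "a \<in> drazin_invertibles"
  then obtain c k where comm: "a * c = c * a" and ck: "a ^ k = a ^ (k + 1) * c"
    by (elim drazin_invertiblesE)
  have pow: "(a * a) ^ n = a ^ (2 * n)" for n
    by (simp add: power_mult power2_eq_square)
  \<comment> \<open>One step for \<open>a * a\<close> raises the exponent of \<open>a\<close> by
    two, so the relation is used twice, giving the witness \<open>c * c\<close>.\<close>
  have "a ^ (2 * k) = a ^ (2 * k + 1) * c"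
    by (rule pow_absorb_mono[OF ck]) simp
  moreover have "a ^ (2 * k + 1) = a ^ (2 * k + 1 + 1) * c"
    by (rule pow_absorb_mono[OF ck]) simp
  ultimately have "a ^ (2 * k) = a ^ (2 * k + 1 + 1) * c * c"
    by metis
  then have "(a * a) ^ k = (a * a) ^ (k + 1) * (c * c)"
    unfolding pow by (simp add: mult.assoc)
  then show "a * a \<in> drazin_invertibles"
    by (rule drazin_invertiblesI[rotated]) (metis comm mult.assoc)
qed

text \<open>The exponent is a successor because at \<open>0\<close> the two sides would be
  \<open>1\<close> and \<open>e\<close>.\<close>

lemma power_mult_idem:
  fixes e x :: "'a::monoid_mult"
  assumes "e * e = e" and "e * x = x * e"
  shows "(e * x) ^ Suc n = e * x ^ Suc n"
proof (induction n)
  case (Suc n)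
  have "(e * x) ^ Suc (Suc n) = e * x * (e * x ^ Suc n)"
    using Suc by simp
  also have "\<dots> = e * (e * x) * x ^ Suc n"
    by (metis assms(2) mult.assoc)
  finally show ?case using assms(1) by (simp flip: mult.assoc)
qed simp

text \<open>By double commutation \<open>c\<close> commutes with \<open>e\<close>, so
  \<open>c\<close> itself meets the conditions of \<open>drazin_invertiblesI\<close> for
  \<open>e * x\<close>.\<close>

lemma drazin_mult_idem:
  fixes e x :: "'a::monoid_mult"
  assumes ee: "e * e = e" and ex: "e * x = x * e" and "x \<in> drazin_invertibles"
  shows "e * x \<in> drazin_invertibles"
proof -
  obtain c k where comm: "x * c = c * x" and cac: "c * x * c = c"
    and ck: "x ^ k = x ^ (k + 1) * c" and "k > 0"
    using assms(3) by (elim drazin_invertiblesE)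
  obtain n where k: "k = Suc n" using \<open>k > 0\<close> by (cases k) auto
  have ce: "c * e = e * c"
    using drazin_inverse_double_commute[OF comm cac ck] ex by simp
  have "(e * x) ^ k = (e * x) ^ (k + 1) * c"
    using ck unfolding k by (simp add: power_mult_idem[OF ee ex] mult.assoc del: power_Suc)
  moreover have "e * x * c = c * (e * x)"
    using comm ce by (metis mult.assoc)
  ultimately show ?thesis by (intro drazin_invertiblesI)
qed

text \<open>Conversely to \<open>drazin_mult_idem\<close>, inverses \<open>u\<close> and
  \<open>v\<close> of the two corners glue to \<open>e * u + f * v\<close>, where
  \<open>e + f = 1\<close>.\<close>

lemma drazin_idem_split:
  fixes e x :: "'a::{ring, monoid_mult}"
  assumes ee: "e * e = e" and ex: "e * x = x * e"
  shows "x \<in> drazin_invertibles \<longleftrightarrow>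
    e * x \<in> drazin_invertibles \<and> (1 - e) * x \<in> drazin_invertibles"
proof (intro iffI conjI)
  define f where "f = 1 - e"
  have ff: "f * f = f" and fx: "f * x = x * f"
    using ee ex by (simp_all add: f_def algebra_simps)
  {
    assume "x \<in> drazin_invertibles"
    then show "e * x \<in> drazin_invertibles" "(1 - e) * x \<in> drazin_invertibles"
      using drazin_mult_idem[OF ee ex] drazin_mult_idem[OF ff fx] by (simp_all add: f_def)
  next
    assume "e * x \<in> drazin_invertibles \<and> (1 - e) * x \<in> drazin_invertibles"
    then obtain u k v l where
      u: "e * x * u = u * (e * x)" "u * (e * x) * u = u" "(e * x) ^ k = (e * x) ^ (k + 1) * u" and
      v: "f * x * v = v * (f * x)" "v * (f * x) * v = v" "(f * x) ^ l = (f * x) ^ (l + 1) * v"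
      unfolding f_def by (auto elim!: drazin_invertiblesE)
    have ue: "u * e = e * u"
      by (rule drazin_inverse_double_commute[OF u]) (metis ee ex mult.assoc)
    have vf: "v * f = f * v"
      by (rule drazin_inverse_double_commute[OF v]) (metis ff fx mult.assoc)
    \<comment> \<open>\<open>Suc n\<close> is an exponent that works for both corners and is
      positive, as \<open>pe\<close> and \<open>pf\<close> require.\<close>
    define n where "n = k + l"
    have pe: "(e * x) ^ Suc i = e * x ^ Suc i" and pf: "(f * x) ^ Suc i = f * x ^ Suc i" for i
      using power_mult_idem[OF ee ex] power_mult_idem[OF ff fx] by auto
    have un: "e * x ^ Suc n = e * x ^ Suc (Suc n) * u"
      using pow_absorb_mono[OF u(3), of "Suc n"] by (simp only: n_def Suc_eq_plus1[symmetric] pe)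
    have vn: "f * x ^ Suc n = f * x ^ Suc (Suc n) * v"
      using pow_absorb_mono[OF v(3), of "Suc n"] by (simp only: n_def Suc_eq_plus1[symmetric] pf)
    have comm1: "x * (e * u) = e * u * x"
      by (metis ex u(1) ue mult.assoc)
    have comm2: "x * (f * v) = f * v * x"
      by (metis fx v(1) vf mult.assoc)
    show "x \<in> drazin_invertibles"
    proof (rule drazin_invertiblesI)
      show "x * (e * u + f * v) = (e * u + f * v) * x"
        using comm1 comm2 by (simp add: distrib_left distrib_right)
      have pex: "x ^ i * e = e * x ^ i" and pfx: "x ^ i * f = f * x ^ i" for i
        using power_commuting_commutes[of x e i] power_commuting_commutes[of x f i] ex fx by auto
      have "x ^ (Suc n + 1) * (e * u + f * v) = e * x ^ Suc (Suc n) * u + f * x ^ Suc (Suc n) * v"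
        by (simp only: distrib_left mult.assoc[symmetric] pex pfx Suc_eq_plus1)
      also have "\<dots> = (e + f) * x ^ Suc n"
        by (simp only: un[symmetric] vn[symmetric] distrib_right)
      finally show "x ^ Suc n = x ^ (Suc n + 1) * (e * u + f * v)"
        by (simp add: f_def)
    qed
  }
qed

section \<open>Corners cut out by an idempotent, and the equivalences\<close>

lemma idem_drazin:
  fixes e :: "'a::monoid_mult"
  assumes "e * e = e"
  shows "e \<in> drazin_invertibles"
  by (rule drazin_invertiblesI[where c = e and k = 1]) (simp_all add: assms)

text \<open>Jacobson exchange of \<open>p\<close> and \<open>p * x\<close> replaces
  \<open>1 - p * x\<close> by \<open>1 - p * x * p\<close>, which commutes with \<open>p\<close>. Of
  its two corners, the complementary one is the idempotent \<open>1 - p\<close>, so only the other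
  matters.\<close>

lemma one_minus_prod_drazin_iff:
  fixes p x :: "'a::{ring, monoid_mult}"
  assumes pp: "p * p = p"
  shows "1 - p * x \<in> drazin_invertibles \<longleftrightarrow> p - p * x * p \<in> drazin_invertibles"
proof -
  have "1 - p * x \<in> drazin_invertibles \<longleftrightarrow> 1 - p * x * p \<in> drazin_invertibles"
    using jacobson_drazin[of p "p * x"] jacobson_drazin[of "p * x" p] pp
    by (auto simp flip: mult.assoc)
  also have "\<dots> \<longleftrightarrow> p * (1 - p * x * p) \<in> drazin_invertibles
      \<and> (1 - p) * (1 - p * x * p) \<in> drazin_invertibles"
  proof (rule drazin_idem_split[OF pp])
    show "p * (1 - p * x * p) = (1 - p * x * p) * p"
      using pp by (simp add: left_diff_distrib right_diff_distrib mult.assoc)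
        (simp add: pp flip: mult.assoc)
  qed
  also have "p * (1 - p * x * p) = p - p * x * p"
    using pp by (simp add: right_diff_distrib flip: mult.assoc)
  also have "(1 - p) * (1 - p * x * p) = 1 - p"
    using pp by (simp add: right_diff_distrib left_diff_distrib flip: mult.assoc)
  finally show ?thesis
    using idem_drazin[of "1 - p"] pp by (simp add: algebra_simps)
qed

theorem theorem3p3:
  fixes p q :: "'a::{ring, monoid_mult}"
  assumes "p ^ 2 = p" and "q ^ 2 = q"
  shows "(p - q \<in> drazin_invertibles \<longleftrightarrow> 1 - p * q \<in> drazin_invertibles) \<and>
         (1 - p * q \<in> drazin_invertibles \<longleftrightarrow> p + q - p * q \<in> drazin_invertibles)"
proof -
  let ?D = "drazin_invertibles :: 'a set"
  have pp: "p * p = p" and qq: "q * q = q"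
    using assms by (simp_all add: power2_eq_square)
  have pp': "p * (p * z) = p * z" and qq': "q * (q * z) = q * z" for z
    using pp qq by (simp_all flip: mult.assoc)
  note simps = left_diff_distrib right_diff_distrib mult.assoc pp qq pp' qq'
  define r where "r = 1 - p"
  have rr: "r * r = r"
    by (simp add: r_def simps)
  have sq: "p * ((p - q) * (p - q)) = (p - q) * (p - q) * p"
    by (simp add: simps)
  have corner_p: "p * ((p - q) * (p - q)) = p - p * q * p"
    by (simp add: simps)
  have corner_r: "(1 - p) * ((p - q) * (p - q)) = r * q * r"
    by (simp add: r_def simps)
  have first: "1 - p * q \<in> ?D \<longleftrightarrow> p - p * q * p \<in> ?D"
    by (rule one_minus_prod_drazin_iff[OF pp])
  \<comment> \<open>This prepares the corner criterion for the idempotent \<open>r\<close> and the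
    factor \<open>1 - q\<close>.\<close>
  have "p + q - p * q = 1 - r * (1 - q)" and "r - r * (1 - q) * r = r * q * r"
    using rr by (simp_all add: r_def simps)
  then have third: "p + q - p * q \<in> ?D \<longleftrightarrow> r * q * r \<in> ?D"
    using one_minus_prod_drazin_iff[OF rr, of "1 - q"] by simp
  \<comment> \<open>Doubling the idempotents \<open>r\<close> and \<open>q\<close> shows both
    elements as products of \<open>q * r\<close> and \<open>r * q\<close>, in opposite
    orders.\<close>
  have "q - q * p * q = q * r * (r * q)" and "r * q * r = r * q * (q * r)"
    by (simp_all add: r_def simps)
  then have "q - q * p * q \<in> ?D \<longleftrightarrow> r * q * r \<in> ?D"
    using cline_drazin[of "q * r" "r * q"] cline_drazin[of "r * q" "q * r"] by auto
  then have "1 - p * q \<in> ?D \<longleftrightarrow> r * q * r \<in> ?D"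
    using one_minus_prod_drazin_iff[OF qq, of p] jacobson_drazin[of p q] jacobson_drazin[of q p]
    by blast
  moreover have "p - q \<in> ?D \<longleftrightarrow> p - p * q * p \<in> ?D \<and> r * q * r \<in> ?D"
    using drazin_idem_split[OF pp sq] square_drazin_iff[of "p - q"]
    unfolding corner_p corner_r by simp
  \<comment> \<open>Both corners are now equivalent to \<open>1 - p * q\<close>, so the conjunction
    describing \<open>p - q\<close> reduces to either one.\<close>
  ultimately show ?thesis
    using first third by blast
qed

end
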